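(* Let $S$ be a nontrivial semigroup (i.e. a semigroup with more than one element), considered in the language $\mathcal{L}=\{\cdot\}$ (with no constants). Then $S$ is not an equational domain.
   Context: A semigroup is a non-empty set with an associative binary operation $\cdot$. It is trivial if it contains a single element. A term of the language $\mathcal{L}=\{\cdot\}$ in a finite set of variables $X=\{x_1,\dots,x_n\}$ is a finite (non-empty) product of variables from $X$; no constants from the semigroup are allowed. An equation over $\mathcal{L}$ is an equality $\tau(X)=\sigma(X)$ of two terms. A system of equations is an arbitrary (possibly infinite) set of equations. The solution set of a system $\mathcal{S}$ in variables $x_1,\dots,x_n$ in a semigroup $S$ is the set $\mathrm{V}_S(\mathcal{S})\subseteq S^n$ of all points of $S^n$ satisfying every equation of $\mathcal{S}$. A set $Y\subseteq S^n$ is algebraic over $S$ if $Y=\mathrm{V}_S(\mathcal{S})$ for some system $\mathcal{S}$ in variables $x_1,\dots,x_n$. A semigroup $S$ is an equational domain (e.d.) if any finite union $Y_1\cup Y_2\cup\dots\cup Y_k$ ($k\ge 1$) of algebraic sets over $S$ (all contained in the same $S^n$, for any $n\geq 1$) is algebraic over $S$. *)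

theory Defs
  imports Main
begin

text \<open>
  A semigroup is given by its multiplication \<open>mul :: 'a \<Rightarrow> 'a \<Rightarrow> 'a\<close> on the (non-empty) type \<open>'a\<close>,
  which satisfies the locale predicate \<^const>\<open>semigroup\<close>. Terms of the language with a single binary
  operation symbol and no constants are binary trees; \<open>Var i\<close> with \<open>i < n\<close> stands for the
  variable with index \<open>i + 1\<close> among \<open>n\<close> variables.
\<close>

datatype sg_term = Var nat | Mult sg_term sg_term

fun vars :: "sg_term \<Rightarrow> nat set" where
  "vars (Var i) = {i}"
| "vars (Mult t u) = vars t \<union> vars u"

text \<open>Points of the \<open>n\<close>-th power of the semigroup are lists of length \<open>n\<close>.\<close>

fun eval_term :: "('a \<Rightarrow> 'a \<Rightarrow> 'a) \<Rightarrow> 'a list \<Rightarrow> sg_term \<Rightarrow> 'a" where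
  "eval_term mul p (Var i) = p ! i"
| "eval_term mul p (Mult t u) = mul (eval_term mul p t) (eval_term mul p u)"

definition is_system :: "nat \<Rightarrow> (sg_term \<times> sg_term) set \<Rightarrow> bool" where
  "is_system n E \<longleftrightarrow> (\<forall>(t, u) \<in> E. vars t \<subseteq> {..<n} \<and> vars u \<subseteq> {..<n})"

definition solution_set ::
  "('a \<Rightarrow> 'a \<Rightarrow> 'a) \<Rightarrow> nat \<Rightarrow> (sg_term \<times> sg_term) set \<Rightarrow> 'a list set" where
  "solution_set mul n E =
     {p. length p = n \<and> (\<forall>(t, u) \<in> E. eval_term mul p t = eval_term mul p u)}"

definition algebraic :: "('a \<Rightarrow> 'a \<Rightarrow> 'a) \<Rightarrow> nat \<Rightarrow> 'a list set \<Rightarrow> bool" where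
  "algebraic mul n Y \<longleftrightarrow> (\<exists>E. is_system n E \<and> Y = solution_set mul n E)"

definition equational_domain :: "('a \<Rightarrow> 'a \<Rightarrow> 'a) \<Rightarrow> bool" where
  "equational_domain mul \<longleftrightarrow>
     (\<forall>n \<ge> 1. \<forall>\<Y>. finite \<Y> \<and> \<Y> \<noteq> {} \<and> (\<forall>Y \<in> \<Y>. algebraic mul n Y) \<longrightarrow> algebraic mul n (\<Union>\<Y>))"

end

theory Submission
  imports Defs
begin

text \<open>
  The union of \<open>x = y\<close> and \<open>x = z\<close> in three variables is never algebraic: some point \<open>(a, b, b)\<close>
  with \<open>a \<noteq> b\<close> satisfies every equation that holds at \<open>(a, a, a)\<close>, \<open>(a, a, b)\<close> and \<open>(a, b, a)\<close>.
  If some \<open>x\<close> is not idempotent, take \<open>a = x\<close> and \<open>b = x\<^sup>2\<close>: replacing \<open>x\<close> by \<open>x\<^sup>2\<close> in one variable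
  multiplies the value of a term by a fixed power of \<open>x\<close>, and these operations commute. Otherwise the
  semigroup is a band, and a nontrivial band contains a two-element semilattice, left zero band or
  right zero band \<open>{a, b}\<close>; there the value of a term at \<open>(a, b, b)\<close> is determined by its
  values at \<open>(a, a, b)\<close> and \<open>(a, b, a)\<close>.
\<close>

text \<open>For points of length \<open>n\<close>, this says that \<open>q\<close> lies in the
  smallest algebraic set containing \<open>P\<close>.\<close>

definition determines ::
  "('a \<Rightarrow> 'a \<Rightarrow> 'a) \<Rightarrow> nat \<Rightarrow> 'a list set \<Rightarrow> 'a list \<Rightarrow> bool" where
  "determines mul n P q \<longleftrightarrow>
     (\<forall>t u. vars t \<subseteq> {..<n} \<longrightarrow> vars u \<subseteq> {..<n} \<longrightarrow>
        (\<forall>p\<in>P. eval_term mul p t = eval_term mul p u) \<longrightarrow> eval_term mul q t = eval_term mul q u)"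

lemma algebraic_determines:
  assumes "algebraic mul n Y" "P \<subseteq> Y" "determines mul n P q" "length q = n"
  shows "q \<in> Y"
proof -
  obtain E where E: "is_system n E" "Y = solution_set mul n E"
    using assms(1) unfolding algebraic_def by blast
  have "eval_term mul q t = eval_term mul q u" if tu: "(t, u) \<in> E" for t u
  proof -
    have "vars t \<subseteq> {..<n}" "vars u \<subseteq> {..<n}"
      using E(1) tu unfolding is_system_def by auto
    moreover have "\<forall>p\<in>P. eval_term mul p t = eval_term mul p u"
      using E(2) tu assms(2) unfolding solution_set_def by auto
    ultimately show ?thesis
      using assms(3) unfolding determines_def by blast
  qed
  then show ?thesis
    using E(2) assms(4) unfolding solution_set_def by auto
qed

lemma algebraic_diagonal:
  assumes "i < n" "j < n"
  shows "algebraic mul n {p. length p = n \<and> p ! i = p ! j}"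
  unfolding algebraic_def
  by (rule exI[of _ "{(Var i, Var j)}"]) (use assms in \<open>auto simp: is_system_def solution_set_def\<close>)

lemma not_equational_domain_if_determines:
  assumes "a \<noteq> b" "determines mul 3 {[a, a, a], [a, a, b], [a, b, a]} [a, b, b]"
  shows "\<not> equational_domain mul"
proof
  let ?D = "\<lambda>i. {p :: 'a list. length p = 3 \<and> p ! 0 = p ! i}"
  assume "equational_domain mul"
  moreover have "algebraic mul 3 (?D 1)" "algebraic mul 3 (?D 2)"
    by (rule algebraic_diagonal; simp)+
  ultimately have "algebraic mul 3 (\<Union>{?D 1, ?D 2})"
    unfolding equational_domain_def
    by (elim allE[of _ 3] impE allE[of _ "{?D 1, ?D 2}"]) auto
  \<comment> \<open>The first two points of the triple lie in \<open>?D 1\<close> and the third in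
    \<open>?D 2\<close>, but \<open>[a, b, b]\<close> lies in neither.\<close>
  then have "[a, b, b] \<in> \<Union>{?D 1, ?D 2}"
    by (rule algebraic_determines[OF _ _ assms(2)]) auto
  then show False
    using assms(1) by simp
qed

primrec weight :: "(nat \<Rightarrow> nat) \<Rightarrow> sg_term \<Rightarrow> nat" where
  "weight w (Var i) = w i"
| "weight w (Mult t u) = weight w t + weight w u"

context semigroup
begin

lemma funpow_mult_left: "((f x ^^ i) u) \<^bold>* v = (f x ^^ i) (u \<^bold>* v)"
  by (induction i) (simp_all add: assoc)

lemma funpow_mult_right:
  assumes "u \<^bold>* x = x \<^bold>* u"
  shows "u \<^bold>* (f x ^^ j) v = (f x ^^ j) (u \<^bold>* v)"
proof (induction j)
  case (Suc j)
  have "u \<^bold>* (x \<^bold>* (f x ^^ j) v) = x \<^bold>* (u \<^bold>* (f x ^^ j) v)"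
    using assms by (simp flip: assoc)
  with Suc show ?case
    by simp
qed simp

lemma eval_term_commute:
  assumes "\<forall>i\<in>vars t. p ! i \<^bold>* x = x \<^bold>* p ! i"
  shows "eval_term f p t \<^bold>* x = x \<^bold>* eval_term f p t"
  using assms
proof (induction t)
  case (Mult t u)
  then have "eval_term f p t \<^bold>* x = x \<^bold>* eval_term f p t"
    "eval_term f p u \<^bold>* x = x \<^bold>* eval_term f p u"
    by auto
  then show ?case
    by (metis assoc eval_term.simps(2))
qed simp

text \<open>Since \<open>x\<close> commutes with the value of the left factor, the copies of
  \<open>x\<close> inside the right factor can be moved to the front. Iterating \<open>f x\<close>
  stands in for a power of \<open>x\<close>, because the weight may be 0 and there need not be an
  identity.\<close>

lemma eval_term_funpow:
  assumes "\<forall>i\<in>vars t. p ! i \<^bold>* x = x \<^bold>* p ! i" "\<forall>i\<in>vars t. q ! i = (f x ^^ w i) (p ! i)"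
  shows "eval_term f q t = (f x ^^ weight w t) (eval_term f p t)"
  using assms
proof (induction t)
  case (Mult t u)
  let ?t = "eval_term f p t" and ?u = "eval_term f p u"
  have "eval_term f q (Mult t u) = (f x ^^ weight w t) ?t \<^bold>* (f x ^^ weight w u) ?u"
    using Mult by simp
  also have "\<dots> = (f x ^^ weight w t) (?t \<^bold>* (f x ^^ weight w u) ?u)"
    by (rule funpow_mult_left)
  also have "?t \<^bold>* (f x ^^ weight w u) ?u = (f x ^^ weight w u) (?t \<^bold>* ?u)"
    using Mult.prems by (intro funpow_mult_right eval_term_commute) simp
  finally show ?case
    by (simp add: funpow_add)
qed simp

lemma determines_square:
  defines "s \<equiv> \<lambda>x. x \<^bold>* x"
  shows "determines f 3 {[x, x, x], [x, x, s x], [x, s x, x]} [x, s x, s x]"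
  unfolding determines_def
proof (intro allI impI)
  fix t u
  let ?e = "eval_term f"
  let ?\<beta> = "\<lambda>t. f x ^^ weight (\<lambda>i. if i = 1 then 1 else 0) t"
  let ?\<gamma> = "\<lambda>t. f x ^^ weight (\<lambda>i. if i = 2 then 1 else 0) t"
  assume "vars t \<subseteq> {..<3}" "vars u \<subseteq> {..<3}"
    and "\<forall>p\<in>{[x, x, x], [x, x, s x], [x, s x, x]}. ?e p t = ?e p u"
  then have eq: "?e [x, x, x] t = ?e [x, x, x] u" "?e [x, x, s x] t = ?e [x, x, s x] u"
    "?e [x, s x, x] t = ?e [x, s x, x] u"
    by auto
  have idx: "i = 0 \<or> i = 1 \<or> i = 2" if "i \<in> vars t \<union> vars u" for i
    using that \<open>vars t \<subseteq> _\<close> \<open>vars u \<subseteq> _\<close> by fastforce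
  have B: "?e [x, s x, x] t = ?\<beta> t (?e [x, x, x] t)"
    and D: "?e [x, s x, s x] t = ?\<beta> t (?e [x, x, s x] t)"
    by (rule eval_term_funpow; use idx in \<open>force simp: s_def assoc\<close>)+
  have C': "?e [x, x, s x] u = ?\<gamma> u (?e [x, x, x] u)"
    and D': "?e [x, s x, s x] u = ?\<gamma> u (?e [x, s x, x] u)"
    by (rule eval_term_funpow; use idx in \<open>force simp: s_def assoc\<close>)+
  \<comment> \<open>The weights of \<open>t\<close> and \<open>u\<close> may differ, so they are
    never compared: the second variable is changed through \<open>t\<close>, the third through
    \<open>u\<close>, and the equation is applied in between.\<close>
  have "?e [x, s x, s x] t = ?\<beta> t (?\<gamma> u (?e [x, x, x] t))"
    by (simp only: D eq C')
  also have "\<dots> = ?\<gamma> u (?\<beta> t (?e [x, x, x] t))"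
    by (simp only: funpow_add[THEN fun_cong, unfolded comp_apply, symmetric] add.commute)
  also have "\<dots> = ?e [x, s x, s x] u"
    by (simp only: D' eq(3)[symmetric] B)
  finally show "?e [x, s x, s x] t = ?e [x, s x, s x] u" .
qed

end

lemma determines_two_element_band:
  assumes idem: "mul a a = a" "mul b b = b"
    and cases: "mul a b = b \<and> mul b a = b \<or> mul a b = a \<and> mul b a = b \<or> mul a b = b \<and> mul b a = a"
  shows "determines mul 3 {[a, a, a], [a, a, b], [a, b, a]} [a, b, b]"
proof -
  let ?e = "eval_term mul"
  \<comment> \<open>These four triples are closed under componentwise products in each of the three
    cases, and their first two entries determine the third. The variables give the first three
    triples; \<open>(b, b, b)\<close> arises in the semilattice case.\<close>
  have "(?e [a, a, b] t, ?e [a, b, a] t, ?e [a, b, b] t)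
      \<in> {(a, a, a), (b, a, b), (a, b, b), (b, b, b)}" if "vars t \<subseteq> {..<3}" for t
    using that
  proof (induction t)
    case (Var i)
    then have "i = 0 \<or> i = 1 \<or> i = 2"
      by fastforce
    then show ?case
      by auto
  next
    case (Mult t u)
    then have "(?e [a, a, b] t, ?e [a, b, a] t, ?e [a, b, b] t)
        \<in> {(a, a, a), (b, a, b), (a, b, b), (b, b, b)}"
      "(?e [a, a, b] u, ?e [a, b, a] u, ?e [a, b, b] u)
        \<in> {(a, a, a), (b, a, b), (a, b, b), (b, b, b)}"
      by auto
    then show ?case
      using idem cases by (elim insertE emptyE disjE) simp_all
  qed
  then show ?thesis
    unfolding determines_def by (smt (verit) insert_iff prod.inject singletonD)
qed

text \<open>If \<open>uvu\<close> differs from \<open>u\<close>, the two form a semilattice.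
  Otherwise the band is rectangular: \<open>xy = x\<close> gives \<open>yx = yxy = y\<close>, so
  \<open>x\<close> and \<open>y\<close> form a left zero band, and if \<open>xy\<close> differs from
  \<open>x\<close>, then \<open>x\<close> and \<open>xy\<close> form a right zero band.\<close>

lemma (in semigroup) ex_two_element_band:
  fixes x y :: 'a
  assumes idem: "\<And>x. x \<^bold>* x = x" and "x \<noteq> y"
  shows "\<exists>a b. a \<noteq> b \<and>
    (a \<^bold>* b = b \<and> b \<^bold>* a = b \<or> a \<^bold>* b = a \<and> b \<^bold>* a = b \<or> a \<^bold>* b = b \<and> b \<^bold>* a = a)"
proof (cases "\<forall>u v. u \<^bold>* v \<^bold>* u = u")
  case False
  then obtain u v where uv: "u \<noteq> u \<^bold>* v \<^bold>* u"
    by metis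
  have "u \<^bold>* (u \<^bold>* v \<^bold>* u) = u \<^bold>* v \<^bold>* u"
    by (simp add: idem flip: assoc)
  moreover have "u \<^bold>* v \<^bold>* u \<^bold>* u = u \<^bold>* v \<^bold>* u"
    by (simp add: idem assoc)
  ultimately show ?thesis
    using uv by blast
next
  case True
  show ?thesis
  proof (cases "x \<^bold>* y = x")
    case xy: True
    then have "y \<^bold>* x = y"
      using True by (metis assoc)
    with xy \<open>x \<noteq> y\<close> show ?thesis
      by blast
  next
    case False
    have "x \<^bold>* (x \<^bold>* y) = x \<^bold>* y"
      by (simp add: idem flip: assoc)
    with True False show ?thesis
      by metis
  qed
qed

theorem theorem3p4:
  fixes mul :: "'a \<Rightarrow> 'a \<Rightarrow> 'a"
  assumes "semigroup mul"
    and "\<exists>x y :: 'a. x \<noteq> y"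
  shows "\<not> equational_domain mul"
proof (cases "\<forall>x. mul x x = x")
  case True
  obtain x y :: 'a where "x \<noteq> y"
    using assms(2) by blast
  then obtain a b where "a \<noteq> b"
    "mul a b = b \<and> mul b a = b \<or> mul a b = a \<and> mul b a = b \<or> mul a b = b \<and> mul b a = a"
    using semigroup.ex_two_element_band[OF assms(1)] True by metis
  then show ?thesis
    using True by (intro not_equational_domain_if_determines determines_two_element_band) auto
next
  case False
  then obtain x where "x \<noteq> mul x x"
    by metis
  then show ?thesis
    by (rule not_equational_domain_if_determines) (rule semigroup.determines_square[OF assms(1)])
qed

end
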